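(* Let $\mathbb P$ be an atomic HTLC-based protocol for a strongly connected swap digraph $G$ in which every asset $(u,v)$ is claimed in the conforming execution exactly at the timeout $\tau_{uv}$ of its contract. Consider the contracts (incoming and outgoing) involving a party $v$ in the conforming execution. (a) For each party $x$ (possibly $x=v$), $v$ has an incoming contract protected by $x$ if and only if $v$ has an outgoing contract protected by $x$. (b) If there are contracts involving $v$ protected by $v$, then at least one incoming contract of $v$ protected by $v$ has a smaller timeout than all outgoing contracts of $v$ protected by $v$. (c) There is at most one party $x\neq v$ that protects a contract involving $v$; for this $x$, all timeouts of the outgoing contracts of $v$ protected by $x$ are smaller than all timeouts of the incoming contracts of $v$ (regardless of which party protects them).
   Context: Swap model: vertices of $G$ are parties; each arc $(u,v)$ is an asset of $u$ (seller) to be transferred to $v$ (buyer). Each party $x$ may create one secret $s_x$ and hashlock $h_x=H(s_x)$ ($H$ a one-way permutation). An HTLC on arc $(u,v)$ is created (at most once) by $u$ with the asset, timeout $\tau_{uv}$ and hashlock $h_x$; the contract is said to be protected by $x$. $v$ obtains the asset by presenting $s_x$ no later than $\tau_{uv}$ (then $u$ learns $s_x$); otherwise after $\tau_{uv}$ it returns to $u$. In an HTLC-based protocol, in each discrete time step any party may create its secret/hashlock pair, create outgoing contracts, and claim incoming assets whose protecting secret it knows; parties can read incoming contracts and may share hashlocks or secrets. Conforming execution: all parties follow $\mathbb P$. Atomic: live (all assets transferred if all conform), safe (every honest party — following $\mathbb P$ until it detects deviation — acquires all its incoming assets or relinquishes none of its outgoing ones, regardless of others), and strong Nash equilibrium.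 *)

theory Defs
  imports "Graph_Theory.Graph_Theory"
begin

text \<open>
  Hashing is modelled symbolically. A party creates at most one secret, so the secret
  $s_x$ and the hashlock $h_x = H(s_x)$ are both named by their creator \<open>x\<close>. One-wayness of
  \<open>H\<close> means that knowing $h_x$ gives no access to $s_x$, while knowing $s_x$ gives $h_x$.
\<close>

record 'v htlc =
  protector :: 'v
  timeout :: nat

datatype 'v msg = Hashlock 'v | Secret 'v

text \<open>
  What a party attempts in one time step. The transition function below ignores every part of
  an action that the party is not able to carry out, so arbitrary actions are admissible.
\<close>

record ('v, 'a) action =
  create_secret :: bool
  create_htlc :: "'a \<Rightarrow> 'v htlc option"
  claim :: "'a set"
  send :: "('v \<times> 'v msg) set"

definition idle :: "('v, 'a) action" where
  "idle = \<lparr>create_secret = False, create_htlc = (\<lambda>_. None), claim = {}, send = {}\<rparr>"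

text \<open>
  Global state at the beginning of a time step. \<open>inbox s v\<close> holds the messages, with their
  senders, delivered to \<open>v\<close> from the preceding step; \<open>claimed s e = Some t\<close> says that the asset
  \<open>e\<close> was transferred to its buyer in step \<open>t\<close>. An asset whose contract expires unclaimed stays
  with (returns to) its seller, so that no state component is needed for it.
\<close>

record ('v, 'a) state =
  secrets :: "'v \<Rightarrow> 'v set"
  hashlocks :: "'v \<Rightarrow> 'v set"
  inbox :: "'v \<Rightarrow> ('v \<times> 'v msg) set"
  htlcs :: "'a \<Rightarrow> 'v htlc option"
  claimed :: "'a \<Rightarrow> nat option"

definition initial_state :: "('v, 'a) state" where
  "initial_state = \<lparr>secrets = (\<lambda>_. {}), hashlocks = (\<lambda>_. {}), inbox = (\<lambda>_. {}),
     htlcs = (\<lambda>_. None), claimed = (\<lambda>_. None)\<rparr>"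

text \<open>A fresh secret/hashlock pair can be used already in the step in which it is created.\<close>

definition usable_secrets ::
  "('v \<Rightarrow> ('v, 'a) action) \<Rightarrow> ('v, 'a) state \<Rightarrow> 'v \<Rightarrow> 'v set" where
  "usable_secrets act s v = secrets s v \<union> (if create_secret (act v) then {v} else {})"

definition usable_hashlocks ::
  "('v \<Rightarrow> ('v, 'a) action) \<Rightarrow> ('v, 'a) state \<Rightarrow> 'v \<Rightarrow> 'v set" where
  "usable_hashlocks act s v = hashlocks s v \<union> (if create_secret (act v) then {v} else {})"

definition creates_htlc ::
  "('v, 'a) pre_digraph \<Rightarrow> ('v \<Rightarrow> ('v, 'a) action) \<Rightarrow> ('v, 'a) state \<Rightarrow> 'a \<Rightarrow> 'v htlc \<Rightarrow> bool" where
  "creates_htlc G act s e c \<longleftrightarrow>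
     e \<in> arcs G \<and> htlcs s e = None \<and>
     create_htlc (act (tail G e)) e = Some c \<and>
     protector c \<in> usable_hashlocks act s (tail G e)"

definition claims ::
  "('v, 'a) pre_digraph \<Rightarrow> nat \<Rightarrow> ('v \<Rightarrow> ('v, 'a) action) \<Rightarrow> ('v, 'a) state \<Rightarrow> 'a \<Rightarrow> bool" where
  "claims G t act s e \<longleftrightarrow>
     e \<in> arcs G \<and> claimed s e = None \<and> e \<in> claim (act (head G e)) \<and>
     (\<exists>c. htlcs s e = Some c \<and> t \<le> timeout c \<and>
          protector c \<in> usable_secrets act s (head G e))"

definition delivered ::
  "('v \<Rightarrow> ('v, 'a) action) \<Rightarrow> ('v, 'a) state \<Rightarrow> 'v \<Rightarrow> ('v \<times> 'v msg) set" where
  "delivered act s v =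
     {(w, Secret x) | w x. (v, Secret x) \<in> send (act w) \<and> x \<in> usable_secrets act s w} \<union>
     {(w, Hashlock x) | w x. (v, Hashlock x) \<in> send (act w) \<and> x \<in> usable_hashlocks act s w}"

definition next_htlcs ::
  "('v, 'a) pre_digraph \<Rightarrow> ('v \<Rightarrow> ('v, 'a) action) \<Rightarrow> ('v, 'a) state \<Rightarrow> 'a \<Rightarrow> 'v htlc option" where
  "next_htlcs G act s e =
     (if \<exists>c. creates_htlc G act s e c then create_htlc (act (tail G e)) e else htlcs s e)"

definition next_secrets ::
  "('v, 'a) pre_digraph \<Rightarrow> nat \<Rightarrow> ('v \<Rightarrow> ('v, 'a) action) \<Rightarrow> ('v, 'a) state \<Rightarrow> 'v \<Rightarrow> 'v set" where
  "next_secrets G t act s v =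
     usable_secrets act s v \<union>
     {x. \<exists>w. (w, Secret x) \<in> delivered act s v} \<union>
     {protector c | c e. e \<in> out_arcs G v \<and> claims G t act s e \<and> htlcs s e = Some c}"

definition next_hashlocks ::
  "('v, 'a) pre_digraph \<Rightarrow> nat \<Rightarrow> ('v \<Rightarrow> ('v, 'a) action) \<Rightarrow> ('v, 'a) state \<Rightarrow> 'v \<Rightarrow> 'v set" where
  "next_hashlocks G t act s v =
     usable_hashlocks act s v \<union> next_secrets G t act s v \<union>
     {x. \<exists>w. (w, Hashlock x) \<in> delivered act s v} \<union>
     {protector c | c e. e \<in> in_arcs G v \<and> next_htlcs G act s e = Some c}"

definition step ::
  "('v, 'a) pre_digraph \<Rightarrow> nat \<Rightarrow> ('v \<Rightarrow> ('v, 'a) action) \<Rightarrow> ('v, 'a) state \<Rightarrow> ('v, 'a) state" where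
  "step G t act s =
     \<lparr>secrets = next_secrets G t act s,
      hashlocks = next_hashlocks G t act s,
      inbox = delivered act s,
      htlcs = next_htlcs G act s,
      claimed = (\<lambda>e. if claims G t act s e then Some t else claimed s e)\<rparr>"

text \<open>
  A party observes its own knowledge and messages, and the contracts on its own incoming and
  outgoing arcs.
\<close>

record ('v, 'a) observation =
  obs_secrets :: "'v set"
  obs_hashlocks :: "'v set"
  obs_inbox :: "('v \<times> 'v msg) set"
  obs_htlcs :: "'a \<Rightarrow> 'v htlc option"
  obs_claimed :: "'a \<Rightarrow> nat option"

definition observe ::
  "('v, 'a) pre_digraph \<Rightarrow> 'v \<Rightarrow> ('v, 'a) state \<Rightarrow> ('v, 'a) observation" where
  "observe G v s =
     \<lparr>obs_secrets = secrets s v,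
      obs_hashlocks = hashlocks s v,
      obs_inbox = inbox s v,
      obs_htlcs = (\<lambda>e. if e \<in> in_arcs G v \<union> out_arcs G v then htlcs s e else None),
      obs_claimed = (\<lambda>e. if e \<in> in_arcs G v \<union> out_arcs G v then claimed s e else None)\<rparr>"

text \<open>
  A strategy chooses the action of step \<open>t\<close> from the party's observations at times \<open>0, \<dots>, t\<close>
  (oldest first). It is defined on all observation histories; on those that do not occur in the
  conforming execution, it describes how the party reacts to a detected deviation.
\<close>

type_synonym ('v, 'a) strategy = "('v, 'a) observation list \<Rightarrow> ('v, 'a) action"

type_synonym ('v, 'a) protocol = "'v \<Rightarrow> ('v, 'a) strategy"

primrec trace :: "('v, 'a) pre_digraph \<Rightarrow> ('v, 'a) protocol \<Rightarrow> nat \<Rightarrow> ('v, 'a) state list" where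
  "trace G P 0 = [initial_state]"
| "trace G P (Suc t) =
     trace G P t @
     [step G t
        (\<lambda>v. if v \<in> verts G then P v (map (observe G v) (trace G P t)) else idle)
        (last (trace G P t))]"

definition state_at :: "('v, 'a) pre_digraph \<Rightarrow> ('v, 'a) protocol \<Rightarrow> nat \<Rightarrow> ('v, 'a) state" where
  "state_at G P t = last (trace G P t)"

text \<open>
  Below, the execution belonging to \<open>P\<close> is the one in which every party \<open>v\<close> plays \<open>P v\<close>: the
  conforming execution if \<open>P\<close> is the protocol itself, and an execution with deviations if some
  of its strategies have been replaced.
\<close>

definition has_htlc ::
  "('v, 'a) pre_digraph \<Rightarrow> ('v, 'a) protocol \<Rightarrow> 'a \<Rightarrow> 'v htlc \<Rightarrow> bool" where
  "has_htlc G P e c \<longleftrightarrow> (\<exists>t. htlcs (state_at G P t) e = Some c)"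

definition claimed_at ::
  "('v, 'a) pre_digraph \<Rightarrow> ('v, 'a) protocol \<Rightarrow> 'a \<Rightarrow> nat \<Rightarrow> bool" where
  "claimed_at G P e t \<longleftrightarrow> (\<exists>n. claimed (state_at G P n) e = Some t)"

definition transferred :: "('v, 'a) pre_digraph \<Rightarrow> ('v, 'a) protocol \<Rightarrow> 'a set" where
  "transferred G P = {e \<in> arcs G. \<exists>t. claimed_at G P e t}"

definition protects ::
  "('v, 'a) pre_digraph \<Rightarrow> ('v, 'a) protocol \<Rightarrow> 'v \<Rightarrow> 'a \<Rightarrow> bool" where
  "protects G P x e \<longleftrightarrow> (\<exists>c. has_htlc G P e c \<and> protector c = x)"

definition live :: "('v, 'a) pre_digraph \<Rightarrow> ('v, 'a) protocol \<Rightarrow> bool" where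
  "live G P \<longleftrightarrow> transferred G P = arcs G"

definition safe :: "('v, 'a) pre_digraph \<Rightarrow> ('v, 'a) protocol \<Rightarrow> bool" where
  "safe G P \<longleftrightarrow>
     (\<forall>v \<in> verts G. \<forall>Q. Q v = P v \<longrightarrow>
        in_arcs G v \<subseteq> transferred G Q \<or> out_arcs G v \<inter> transferred G Q = {})"

text \<open>
  The outcome of a coalition consists of the assets it acquires from, and the assets it
  relinquishes to, parties outside of it. Singleton coalitions are individual parties.
\<close>

type_synonym 'a outcome = "'a set \<times> 'a set"

definition coalition_in :: "('v, 'a) pre_digraph \<Rightarrow> 'v set \<Rightarrow> 'a set" where
  "coalition_in G C = {e \<in> arcs G. tail G e \<notin> C \<and> head G e \<in> C}"

definition coalition_out :: "('v, 'a) pre_digraph \<Rightarrow> 'v set \<Rightarrow> 'a set" where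
  "coalition_out G C = {e \<in> arcs G. tail G e \<in> C \<and> head G e \<notin> C}"

definition outcomes :: "('v, 'a) pre_digraph \<Rightarrow> 'v set \<Rightarrow> 'a outcome set" where
  "outcomes G C = Pow (coalition_in G C) \<times> Pow (coalition_out G C)"

definition outcome ::
  "('v, 'a) pre_digraph \<Rightarrow> ('v, 'a) protocol \<Rightarrow> 'v set \<Rightarrow> 'a outcome" where
  "outcome G P C = (coalition_in G C \<inter> transferred G P, coalition_out G C \<inter> transferred G P)"

text \<open>
  Preferences between outcomes: acquiring more and relinquishing less is never worse, and the
  full swap is strictly better than no exchange. Here \<open>(\<omega>, \<omega>') \<in> pref C\<close> means that \<open>C\<close> finds
  \<open>\<omega>'\<close> at least as good as \<open>\<omega>\<close>.
\<close>

definition preferences ::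
  "('v, 'a) pre_digraph \<Rightarrow> ('v set \<Rightarrow> 'a outcome rel) \<Rightarrow> bool" where
  "preferences G pref \<longleftrightarrow>
     (\<forall>C. C \<noteq> {} \<and> C \<subset> verts G \<longrightarrow>
        preorder_on (outcomes G C) (pref C) \<and>
        (\<forall>(I, O1) \<in> outcomes G C. \<forall>(J, O2) \<in> outcomes G C.
           I \<subseteq> J \<and> O2 \<subseteq> O1 \<longrightarrow> ((I, O1), (J, O2)) \<in> pref C) \<and>
        ((coalition_in G C, coalition_out G C), ({}, {})) \<notin> pref C \<and>
        (({}, {}), (coalition_in G C, coalition_out G C)) \<in> pref C)"

definition strong_nash ::
  "('v, 'a) pre_digraph \<Rightarrow> ('v set \<Rightarrow> 'a outcome rel) \<Rightarrow> ('v, 'a) protocol \<Rightarrow> bool" where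
  "strong_nash G pref P \<longleftrightarrow>
     (\<forall>C Q. C \<noteq> {} \<and> C \<subset> verts G \<and> (\<forall>v \<in> verts G - C. Q v = P v) \<longrightarrow>
        \<not> ((outcome G P C, outcome G Q C) \<in> pref C \<and>
           (outcome G Q C, outcome G P C) \<notin> pref C))"

definition atomic ::
  "('v, 'a) pre_digraph \<Rightarrow> ('v set \<Rightarrow> 'a outcome rel) \<Rightarrow> ('v, 'a) protocol \<Rightarrow> bool" where
  "atomic G pref P \<longleftrightarrow> live G P \<and> safe G P \<and> strong_nash G pref P"

end

theory Submission
  imports Defs
begin

text \<open>
  If all parties except an honest \<open>y\<close> conspire, they can take an
  outgoing asset of \<open>y\<close> whose secret one of them knows, at its timeout, while starving \<open>y\<close> of
  information. By safety \<open>y\<close> must then be able to claim all incoming assets with the secrets it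
  knew before plus the one just revealed, and the latter is of use only for larger timeouts.
  Applied while contracts are being placed, this propagates backwards through the strongly
  connected digraph and shows that no relevant secret is leaked before all contracts exist.
  Applied afterwards, it shows that an outgoing contract of \<open>v\<close> protected by \<open>x \<noteq> v\<close> comes with
  incoming ones protected by \<open>x\<close>, all of them with larger timeouts, and that the remaining incoming
  contracts are protected by \<open>v\<close>; for the converse, \<open>v\<close> itself deviates. Contracts protected by
  \<open>v\<close> itself are then found by following contracts protected by \<open>v\<close> along monotone timeouts.
\<close>

subsection \<open>Executions\<close>

definition acts :: "('v, 'a) pre_digraph \<Rightarrow> ('v, 'a) protocol \<Rightarrow> nat \<Rightarrow> 'v \<Rightarrow> ('v, 'a) action" where
  "acts G Q t w = (if w \<in> verts G then Q w (map (observe G w) (trace G Q t)) else idle)"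

lemma acts_outside [simp]: "w \<notin> verts G \<Longrightarrow> acts G Q t w = idle"
  by (simp add: acts_def)

lemma idle_simps [simp]:
  "create_secret idle = False" "create_htlc idle = (\<lambda>_. None)" "claim idle = {}" "send idle = {}"
  by (simp_all add: idle_def)

lemma length_trace [simp]: "length (trace G Q t) = Suc t"
  by (induction t) auto

lemma state_at_0 [simp]: "state_at G Q 0 = initial_state"
  by (simp add: state_at_def)

lemma state_at_Suc: "state_at G Q (Suc t) = step G t (acts G Q t) (state_at G Q t)"
  by (simp add: state_at_def acts_def[abs_def])

text \<open>Equal traces give equal observations, so actions need only be compared under the
  hypothesis that the two executions agree so far.\<close>

lemma trace_eq_upto:
  assumes "\<And>s w. s < t \<Longrightarrow> w \<in> verts G \<Longrightarrow> trace G Q s = trace G R s \<Longrightarrow> acts G Q s w = acts G R s w"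
    and "s \<le> t"
  shows "trace G Q s = trace G R s"
  using assms(2)
proof (induction s)
  case (Suc s)
  then have eq: "trace G Q s = trace G R s" by simp
  have "acts G Q s = acts G R s"
  proof
    fix w
    show "acts G Q s w = acts G R s w"
      using assms(1)[OF _ _ eq] Suc.prems by (cases "w \<in> verts G") auto
  qed
  then show ?case using eq by (simp add: acts_def[abs_def])
qed simp

lemma acts_eq_of_trace_eq:
  assumes "trace G Q s = trace G R s" and "Q w = R w"
  shows "acts G Q s w = acts G R s w"
  using assms by (simp add: acts_def)

lemma state_at_eq_of_trace_eq: "trace G Q s = trace G R s \<Longrightarrow> state_at G Q s = state_at G R s"
  by (simp add: state_at_def)

lemma secrets_Suc: "secrets (state_at G Q (Suc t)) = next_secrets G t (acts G Q t) (state_at G Q t)"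
  by (simp add: state_at_Suc step_def)

lemma hashlocks_Suc:
  "hashlocks (state_at G Q (Suc t)) = next_hashlocks G t (acts G Q t) (state_at G Q t)"
  by (simp add: state_at_Suc step_def)

lemma htlcs_Suc: "htlcs (state_at G Q (Suc t)) = next_htlcs G (acts G Q t) (state_at G Q t)"
  by (simp add: state_at_Suc step_def)

lemma claimed_Suc:
  "claimed (state_at G Q (Suc t)) e =
     (if claims G t (acts G Q t) (state_at G Q t) e then Some t else claimed (state_at G Q t) e)"
  by (simp add: state_at_Suc step_def)

lemma secrets_SucE:
  assumes "x \<in> secrets (state_at G Q (Suc t)) r"
  obtains (usable) "x \<in> usable_secrets (acts G Q t) (state_at G Q t) r"
    | (message) w where "w \<in> verts G" "(r, Secret x) \<in> send (acts G Q t w)"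
        "x \<in> usable_secrets (acts G Q t) (state_at G Q t) w"
    | (claim) e c where "e \<in> out_arcs G r" "claims G t (acts G Q t) (state_at G Q t) e"
        "htlcs (state_at G Q t) e = Some c" "x = protector c"
proof -
  have "w \<in> verts G" if "(r, Secret x) \<in> send (acts G Q t w)" for w
    using that by (cases "w \<in> verts G") auto
  then show thesis
    using assms usable message "claim"
    unfolding secrets_Suc next_secrets_def delivered_def by blast
qed

lemma secret_delivered:
  assumes "(r, Secret x) \<in> send (acts G Q t w)"
    and "x \<in> usable_secrets (acts G Q t) (state_at G Q t) w"
  shows "x \<in> secrets (state_at G Q (Suc t)) r"
  using assms unfolding secrets_Suc next_secrets_def delivered_def by blast

lemma secrets_mono: "s \<le> t \<Longrightarrow> secrets (state_at G Q s) w \<subseteq> secrets (state_at G Q t) w"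
  by (induction rule: dec_induct) (auto simp: secrets_Suc next_secrets_def usable_secrets_def)

lemma htlcs_mono:
  assumes "htlcs (state_at G Q s) e = Some c" and "s \<le> t"
  shows "htlcs (state_at G Q t) e = Some c"
  using assms(2,1)
  by (induction rule: dec_induct) (auto simp: htlcs_Suc next_htlcs_def creates_htlc_def)

lemma has_htlc_unique:
  assumes "has_htlc G Q e c" and "has_htlc G Q e d"
  shows "c = d"
proof -
  obtain s t where "htlcs (state_at G Q s) e = Some c" "htlcs (state_at G Q t) e = Some d"
    using assms by (auto simp: has_htlc_def)
  then show ?thesis
    using htlcs_mono[of G Q s e c "max s t"] htlcs_mono[of G Q t e d "max s t"] by simp
qed

lemma claimed_imp_claims:
  "claimed (state_at G Q n) e = Some t \<Longrightarrow> t < n \<and> claims G t (acts G Q t) (state_at G Q t) e"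
  by (induction n) (auto simp: claimed_Suc initial_state_def split: if_splits)

lemma transferred_iff:
  "e \<in> transferred G Q \<longleftrightarrow> (\<exists>t. claims G t (acts G Q t) (state_at G Q t) e)"
proof
  assume "e \<in> transferred G Q"
  then show "\<exists>t. claims G t (acts G Q t) (state_at G Q t) e"
    using claimed_imp_claims by (fastforce simp: transferred_def claimed_at_def)
next
  assume "\<exists>t. claims G t (acts G Q t) (state_at G Q t) e"
  then obtain t where t: "claims G t (acts G Q t) (state_at G Q t) e" ..
  then have "claimed (state_at G Q (Suc t)) e = Some t" by (simp add: claimed_Suc)
  moreover have "e \<in> arcs G" using t by (simp add: claims_def)
  ultimately show "e \<in> transferred G Q" by (auto simp: transferred_def claimed_at_def)
qed

lemma transferredI:
  assumes "e \<in> arcs G" and "e \<in> claim (acts G Q t (head G e))"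
    and "htlcs (state_at G Q t) e = Some c" and "t \<le> timeout c"
    and "protector c \<in> usable_secrets (acts G Q t) (state_at G Q t) (head G e)"
  shows "e \<in> transferred G Q"
proof (cases "claimed (state_at G Q t) e")
  case None
  then have "claims G t (acts G Q t) (state_at G Q t) e" using assms by (simp add: claims_def)
  then show ?thesis by (auto simp: transferred_iff)
next
  case (Some s)
  then show ?thesis by (meson claimed_imp_claims transferred_iff)
qed

lemma seller_learns_secret:
  assumes "claims G t (acts G Q t) (state_at G Q t) e" and "htlcs (state_at G Q t) e = Some c"
  shows "protector c \<in> secrets (state_at G Q (Suc t)) (tail G e)"
  using assms by (auto simp: secrets_Suc next_secrets_def claims_def)

lemma buyer_knows_secret:
  assumes "claims G t (acts G Q t) (state_at G Q t) e" and "htlcs (state_at G Q t) e = Some c"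
  shows "protector c = head G e \<or> protector c \<in> secrets (state_at G Q t) (head G e)"
  using assms by (auto simp: claims_def usable_secrets_def split: if_splits)

text \<open>Contracts need a known hashlock, and hashlocks spread through contracts, secrets and
  messages, so the three claims need one simultaneous induction.\<close>

lemma known_imp_created:
  "(x \<in> secrets (state_at G Q t) w \<longrightarrow> x \<in> verts G \<and> x \<in> secrets (state_at G Q t) x) \<and>
   (x \<in> hashlocks (state_at G Q t) w \<longrightarrow> x \<in> verts G \<and> x \<in> secrets (state_at G Q t) x) \<and>
   (htlcs (state_at G Q t) e = Some c \<and> protector c = x \<longrightarrow>
      x \<in> verts G \<and> x \<in> secrets (state_at G Q t) x)"
proof (induction t arbitrary: w e c x)
  case 0
  then show ?case by (simp add: initial_state_def)
next
  case (Suc t)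
  let ?known = "\<lambda>x. x \<in> verts G \<and> x \<in> secrets (state_at G Q (Suc t)) x"
  let ?us = "usable_secrets (acts G Q t) (state_at G Q t)"
  let ?uh = "usable_hashlocks (acts G Q t) (state_at G Q t)"
  have old: "?known x" if "x \<in> secrets (state_at G Q t) x" "x \<in> verts G" for x
    using that secrets_mono[of t "Suc t" G Q x] by auto
  have new: "?known x" if "create_secret (acts G Q t x)" for x
    using that by (cases "x \<in> verts G") (auto simp: secrets_Suc next_secrets_def usable_secrets_def)
  have us: "?known x" if "x \<in> ?us w" for x w
    using that Suc.IH[of x w] old[of x] new[of x]
    by (cases "x \<in> secrets (state_at G Q t) w") (auto simp: usable_secrets_def split: if_splits)
  have uh: "?known x" if "x \<in> ?uh w" for x w
    using that Suc.IH[of x w] old[of x] new[of x]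
    by (cases "x \<in> hashlocks (state_at G Q t) w") (auto simp: usable_hashlocks_def split: if_splits)
  have htlc_old: "?known (protector c)" if "htlcs (state_at G Q t) e = Some c" for e c
    using that Suc.IH old by blast
  have htlc: "?known (protector c)" if "htlcs (state_at G Q (Suc t)) e = Some c" for e c
  proof (cases "\<exists>d. creates_htlc G (acts G Q t) (state_at G Q t) e d")
    case True
    then show ?thesis
      using that uh[of "protector c" "tail G e"] by (auto simp: htlcs_Suc next_htlcs_def creates_htlc_def)
  next
    case False
    then show ?thesis using that htlc_old[of e c] by (simp add: htlcs_Suc next_htlcs_def)
  qed
  have sec: "?known x" if "x \<in> next_secrets G t (acts G Q t) (state_at G Q t) w" for x w
    using that by (auto simp: next_secrets_def delivered_def dest!: us htlc_old)
  have hash: "?known x" if "x \<in> hashlocks (state_at G Q (Suc t)) w" for x w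
    using that
    by (auto simp: hashlocks_Suc next_hashlocks_def delivered_def htlcs_Suc[symmetric]
        dest!: sec uh htlc)
  show ?case using sec hash htlc unfolding secrets_Suc[symmetric] by blast
qed

lemma protector_knows_secret:
  "htlcs (state_at G Q t) e = Some c \<Longrightarrow>
     protector c \<in> verts G \<and> protector c \<in> secrets (state_at G Q t) (protector c)"
  by (rule known_imp_created[THEN conjunct2, THEN conjunct2, THEN mp]) simp

lemma htlcs_imp_arc: "htlcs (state_at G Q t) e = Some c \<Longrightarrow> e \<in> arcs G"
  by (induction t)
    (auto simp: initial_state_def htlcs_Suc next_htlcs_def creates_htlc_def split: if_splits)

subsection \<open>Scripted deviations\<close>

text \<open>
  Since executions are deterministic, a deviation may be given by the actions it performs at each
  time; the length of the observation history is the current time plus one.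
\<close>

definition deviate ::
  "('v, 'a) protocol \<Rightarrow> 'v set \<Rightarrow> (nat \<Rightarrow> 'v \<Rightarrow> ('v, 'a) action) \<Rightarrow> ('v, 'a) protocol" where
  "deviate P C A w h = (if w \<in> C then A (length h - 1) w else P w h)"

lemma acts_deviate_in:
  "w \<in> C \<Longrightarrow> w \<in> verts G \<Longrightarrow> acts G (deviate P C A) s w = A s w"
  by (simp add: acts_def deviate_def)

lemma deviate_outside: "w \<notin> C \<Longrightarrow> deviate P C A w = P w"
  by (simp add: deviate_def fun_eq_iff)

lemma trace_deviate:
  assumes "\<And>s w. s < t \<Longrightarrow> w \<in> C \<Longrightarrow> w \<in> verts G \<Longrightarrow> A s w = acts G P s w" and "s \<le> t"
  shows "trace G (deviate P C A) s = trace G P s"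
proof (rule trace_eq_upto[OF _ assms(2)])
  fix s w
  assume "s < t" "w \<in> verts G" "trace G (deviate P C A) s = trace G P s"
  then show "acts G (deviate P C A) s w = acts G P s w"
    using assms(1) acts_deviate_in[of w C] deviate_outside[of w C] acts_eq_of_trace_eq by metis
qed

lemma trace_deviate_cong:
  assumes "\<And>s w. s < t \<Longrightarrow> w \<in> C \<Longrightarrow> w \<in> verts G \<Longrightarrow> A s w = B s w" and "s \<le> t"
  shows "trace G (deviate P C A) s = trace G (deviate P C B) s"
proof (rule trace_eq_upto[OF _ assms(2)])
  fix s w
  assume "s < t" "w \<in> verts G" "trace G (deviate P C A) s = trace G (deviate P C B) s"
  then show "acts G (deviate P C A) s w = acts G (deviate P C B) s w"
    using assms(1) acts_deviate_in[of w C] deviate_outside[of w C] acts_eq_of_trace_eq by metis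
qed

subsection \<open>Stealing an asset from a single honest party\<close>

locale timely_safe_swap = digraph G
  for G :: "('v, 'a) pre_digraph" and P :: "('v, 'a) protocol" +
  assumes strongly_connected: "strongly_connected G"
    and safe: "safe G P"
    and claimed_at_timeout: "\<forall>e \<in> arcs G. \<exists>c. has_htlc G P e c \<and> claimed_at G P e (timeout c)"
begin

section \<open>Contracts of the conforming execution, and walks in the digraph\<close>

definition contract :: "'a \<Rightarrow> 'v htlc" where
  "contract e = (SOME c. has_htlc G P e c \<and> claimed_at G P e (timeout c))"

abbreviation prot :: "'a \<Rightarrow> 'v" where
  "prot e \<equiv> protector (contract e)"

abbreviation tau :: "'a \<Rightarrow> nat" where
  "tau e \<equiv> timeout (contract e)"

definition placed :: "nat \<Rightarrow> 'a \<Rightarrow> bool" where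
  "placed t e \<longleftrightarrow> htlcs (state_at G P t) e \<noteq> None"

lemma contract:
  assumes "e \<in> arcs G"
  shows "has_htlc G P e (contract e)" and "claimed_at G P e (tau e)"
  using someI_ex[OF claimed_at_timeout[rule_format, OF assms]] by (auto simp: contract_def)

lemma htlcs_eq_contract: "htlcs (state_at G P t) e = Some c \<Longrightarrow> c = contract e"
  by (meson contract(1) has_htlc_def has_htlc_unique htlcs_imp_arc)

lemma has_htlc_iff: "e \<in> arcs G \<Longrightarrow> has_htlc G P e c \<longleftrightarrow> c = contract e"
  using contract(1)[of e] has_htlc_unique[of G P e c "contract e"] by auto

lemma placed_iff: "placed t e \<longleftrightarrow> htlcs (state_at G P t) e = Some (contract e)"
  by (auto simp: placed_def dest: htlcs_eq_contract)

lemma placed_mono: "placed s e \<Longrightarrow> s \<le> t \<Longrightarrow> placed t e"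
  by (auto simp: placed_iff intro: htlcs_mono)

lemma eventually_placed: "e \<in> arcs G \<Longrightarrow> \<exists>t. placed t e"
  using contract(1)[of e] by (auto simp: has_htlc_def placed_iff)

lemma claims_at_tau:
  assumes "e \<in> arcs G"
  shows "claims G (tau e) (acts G P (tau e)) (state_at G P (tau e)) e"
  using contract(2)[OF assms] claimed_imp_claims by (fastforce simp: claimed_at_def)

lemma prot_known:
  assumes "placed t e"
  shows "prot e \<in> verts G" and "prot e \<in> secrets (state_at G P t) (prot e)"
  using assms protector_knows_secret[of G P t e "contract e"] by (auto simp: placed_iff)

lemma out_arcD: "e \<in> out_arcs G y \<Longrightarrow> head G e \<noteq> y \<and> head G e \<in> verts G"
  using no_loops[of e] by auto

lemma in_arcD: "e \<in> in_arcs G y \<Longrightarrow> tail G e \<noteq> y \<and> tail G e \<in> verts G"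
  using no_loops[of e] by auto

lemma in_arcs_nonempty:
  assumes "f \<in> out_arcs G v"
  shows "in_arcs G v \<noteq> {}"
proof -
  have "head G f \<rightarrow>\<^sup>*\<^bsub>G\<^esub> v" "head G f \<noteq> v"
    using assms strongly_connected out_arcD[OF assms] by (auto simp: strongly_connected_def)
  then show ?thesis
    by (induction rule: reachable_induct) (auto simp: arcs_ends_conv)
qed

lemma out_arcs_nonempty:
  assumes "e \<in> in_arcs G v"
  shows "out_arcs G v \<noteq> {}"
proof -
  have "v \<rightarrow>\<^sup>*\<^bsub>G\<^esub> tail G e" "tail G e \<noteq> v"
    using assms strongly_connected in_arcD[OF assms] by (auto simp: strongly_connected_def)
  then show ?thesis
    by (induction rule: converse_reachable_induct) (auto simp: arcs_ends_conv)
qed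

lemma all_verts_of_pred_closed:
  assumes "S u" and "u \<in> verts G"
    and "\<And>e. e \<in> arcs G \<Longrightarrow> S (head G e) \<Longrightarrow> S (tail G e)"
    and "w \<in> verts G"
  shows "S w"
proof -
  have "w \<rightarrow>\<^sup>*\<^bsub>G\<^esub> u" using assms strongly_connected by (auto simp: strongly_connected_def)
  then show ?thesis
    using assms by (induction rule: converse_reachable_induct) (auto simp: arcs_ends_conv)
qed

text \<open>
  From time \<open>t\<close> on, the parties other than \<open>y\<close> starve \<open>y\<close>: they create no contracts, tell \<open>y\<close>
  nothing, and claim no asset of \<open>y\<close>, except that \<open>f\<close> is claimed at the last possible moment.
  Among themselves they share everything they know.
\<close>

definition steal_action :: "'v \<Rightarrow> nat \<Rightarrow> 'a \<Rightarrow> nat \<Rightarrow> 'v \<Rightarrow> ('v, 'a) action" where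
  "steal_action y t f s w =
     (if s < t then acts G P s w
      else (acts G P s w)\<lparr>create_htlc := (\<lambda>_. None),
             claim := (claim (acts G P s w) - out_arcs G y) \<union> (if s = tau f then {f} else {}),
             send := (- {y}) \<times> UNIV\<rparr>)"

definition steal :: "'v \<Rightarrow> nat \<Rightarrow> 'a \<Rightarrow> ('v, 'a) protocol" where
  "steal y t f = deviate P (- {y}) (steal_action y t f)"

lemma steal_honest: "steal y t f y = P y"
  by (simp add: steal_def deviate_outside)

lemma acts_steal:
  "w \<noteq> y \<Longrightarrow> w \<in> verts G \<Longrightarrow> acts G (steal y t f) s w = steal_action y t f s w"
  by (simp add: steal_def acts_deviate_in)

text \<open>The script replays the conforming action of \<open>w\<close> whatever \<open>w\<close>
  now observes, so secrets are created on schedule.\<close>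

lemma create_secret_steal [simp]:
  "w \<noteq> y \<Longrightarrow> create_secret (acts G (steal y t f) s w) = create_secret (acts G P s w)"
  by (cases "w \<in> verts G") (simp_all add: acts_steal steal_action_def)

lemma trace_steal: "s \<le> t \<Longrightarrow> trace G (steal y t f) s = trace G P s"
  unfolding steal_def by (rule trace_deviate[of t]) (auto simp: steal_action_def)

lemma state_steal: "s \<le> t \<Longrightarrow> state_at G (steal y t f) s = state_at G P s"
  by (rule state_at_eq_of_trace_eq[OF trace_steal])

lemma acts_steal_honest: "s \<le> t \<Longrightarrow> acts G (steal y t f) s y = acts G P s y"
  by (rule acts_eq_of_trace_eq[OF trace_steal steal_honest])

lemma acts_steal_before: "s < t \<Longrightarrow> acts G (steal y t f) s = acts G P s"
proof
  fix w
  assume "s < t"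
  then show "acts G (steal y t f) s w = acts G P s w"
    by (cases "w \<in> verts G"; cases "w = y")
      (auto simp: acts_steal acts_steal_honest steal_action_def)
qed

section \<open>What the starved party can still learn and claim\<close>

lemma htlcs_steal_in:
  assumes "e \<in> in_arcs G y" and "t \<le> s"
  shows "htlcs (state_at G (steal y t f) s) e = htlcs (state_at G P t) e"
  using assms(2)
proof (induction rule: dec_induct)
  case base
  then show ?case by (simp add: state_steal)
next
  case (step s)
  have "tail G e \<noteq> y" "tail G e \<in> verts G" using in_arcD[OF assms(1)] by auto
  then show ?case
    using step by (simp add: htlcs_Suc next_htlcs_def creates_htlc_def acts_steal steal_action_def)
qed

lemma htlcs_steal_target:
  assumes "f \<in> out_arcs G y" and "placed (Suc t) f" and "Suc t \<le> s"
  shows "htlcs (state_at G (steal y t f') s) f = Some (contract f)"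
proof -
  have "htlcs (state_at G (steal y t f') (Suc t)) f = htlcs (state_at G P (Suc t)) f"
    using assms(1) by (auto simp: htlcs_Suc next_htlcs_def creates_htlc_def usable_hashlocks_def
        state_steal acts_steal_honest)
  then show ?thesis using assms by (auto simp: placed_iff intro: htlcs_mono)
qed

text \<open>No deviator sends to \<open>y\<close>, and only the claim of \<open>f\<close> in step
  \<open>tau f\<close> reveals a secret to it. The seller learns it one step later, whence the
  strict \<open>tau f < s\<close>.\<close>

lemma secrets_steal_honest:
  assumes "f \<in> out_arcs G y" and "placed (Suc t) f" and "t \<le> s"
  shows "secrets (state_at G (steal y t f) s) y \<subseteq>
    {y} \<union> secrets (state_at G P t) y \<union> (if tau f < s then {prot f} else {})"
  using assms(3)
proof (induction rule: dec_induct)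
  case base
  then show ?case by (auto simp: state_steal)
next
  case (step s)
  let ?Q = "steal y t f"
  let ?K = "{y} \<union> secrets (state_at G P t) y \<union> (if tau f < Suc s then {prot f} else {})"
  have usable_y: "usable_secrets (acts G ?Q s) (state_at G ?Q s) y \<subseteq> ?K"
    using step by (auto simp: usable_secrets_def split: if_splits)
  have claimed_y: "protector c \<in> ?K"
    if "e \<in> out_arcs G y" "claims G s (acts G ?Q s) (state_at G ?Q s) e"
      "htlcs (state_at G ?Q s) e = Some c" for e c
  proof -
    have "head G e \<noteq> y" "head G e \<in> verts G" using out_arcD[OF that(1)] by auto
    then have "e = f" "s = tau f"
      using that step(1) by (auto simp: claims_def acts_steal steal_action_def split: if_splits)
    moreover have "c = contract f"
    proof (cases "s = t")
      case True
      then show ?thesis using that \<open>e = f\<close> htlcs_eq_contract by (simp add: state_steal)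
    next
      case False
      then show ?thesis
        using that \<open>e = f\<close> step(1) htlcs_steal_target[OF assms(1,2), of s f] by auto
    qed
    ultimately show ?thesis by simp
  qed
  show ?case
  proof
    fix x
    assume "x \<in> secrets (state_at G ?Q (Suc s)) y"
    then show "x \<in> ?K"
    proof (cases rule: secrets_SucE)
      case usable
      then show ?thesis using usable_y by blast
    next
      case (message w)
      then have "w = y" using step(1) by (cases "w = y") (auto simp: acts_steal steal_action_def)
      then show ?thesis using message usable_y by blast
    next
      case (claim e c)
      then show ?thesis using claimed_y by blast
    qed
  qed
qed

lemma honest_claim_under_steal:
  assumes f: "f \<in> out_arcs G y" "placed (Suc t) f" and e: "e \<in> in_arcs G y"
    and cl: "claims G s (acts G (steal y t f) s) (state_at G (steal y t f) s) e"
  shows "placed t e \<and> s \<le> tau e \<and>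
    (prot e = y \<or> prot e \<in> secrets (state_at G P t) y \<or> prot e = prot f \<and> tau f < s)"
proof -
  obtain c where c: "htlcs (state_at G (steal y t f) s) e = Some c" "s \<le> timeout c"
      "protector c \<in> usable_secrets (acts G (steal y t f) s) (state_at G (steal y t f) s) y"
    using cl e by (auto simp: claims_def)
  have known: "protector c = y \<or> protector c \<in> secrets (state_at G (steal y t f) s) y"
    using c(3) by (auto simp: usable_secrets_def split: if_splits)
  show ?thesis
  proof (cases "s < t")
    case True
    then have "htlcs (state_at G P s) e = Some c" using c(1) by (simp add: state_steal)
    then have "c = contract e" "placed s e" using htlcs_eq_contract by (auto simp: placed_def)
    then show ?thesis
      using True c known secrets_mono[of s t G P y] placed_mono[of s e t]
      by (auto simp: state_steal)
  next
    case False
    then have "htlcs (state_at G P t) e = Some c" using c(1) htlcs_steal_in[OF e, of t s] by simp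
    then have "c = contract e" "placed t e" using htlcs_eq_contract by (auto simp: placed_def)
    then show ?thesis
      using False c known secrets_steal_honest[OF f, of s] by (auto split: if_splits)
  qed
qed

text \<open>A secret sent by \<open>r\<close> in step \<open>s\<close> arrives at
  \<open>s + 1\<close>; hence \<open>s < tau f\<close>, unless \<open>r\<close> is itself the
  buyer.\<close>

lemma steal_succeeds:
  assumes f: "f \<in> out_arcs G y" "placed (Suc t) f"
    and r: "r \<in> verts G" "r \<noteq> y" "prot f \<in> secrets (state_at G (steal y t f) s) r"
    and s: "Suc t \<le> s" "s < tau f \<or> s = tau f \<and> r = head G f"
  shows "f \<in> transferred G (steal y t f)"
proof -
  let ?Q = "steal y t f"
  have hd: "head G f \<noteq> y" "head G f \<in> verts G" using f out_arcD[OF f(1)] by auto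
  have "prot f \<in> secrets (state_at G ?Q (tau f)) (head G f)"
  proof (cases "s = tau f \<and> r = head G f")
    case True
    then show ?thesis using r by simp
  next
    case False
    then have "Suc s \<le> tau f" using s by auto
    moreover have "prot f \<in> secrets (state_at G ?Q (Suc s)) (head G f)"
      using r s(1) hd
      by (intro secret_delivered[of _ _ G _ s r])
        (auto simp: acts_steal steal_action_def usable_secrets_def)
    ultimately show ?thesis using secrets_mono[of "Suc s" "tau f" G ?Q "head G f"] by blast
  qed
  moreover have "f \<in> claim (acts G ?Q (tau f) (head G f))"
    using hd s by (auto simp: acts_steal steal_action_def)
  ultimately show ?thesis
    using f s htlcs_steal_target[OF f, of "tau f" f]
    by (intro transferredI[where t = "tau f" and c = "contract f"]) (auto simp: usable_secrets_def)
qed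

text \<open>Step \<open>t\<close> is the first altered one. It drops only new contracts, messages to
  \<open>y\<close> and claims of assets of \<open>y\<close>, none of which would teach a secret to
  anyone but \<open>y\<close>.\<close>

lemma secrets_steal_others:
  assumes "r \<noteq> y" and "x \<in> secrets (state_at G P (Suc t)) r"
  shows "x \<in> secrets (state_at G (steal y t f) (Suc t)) r"
proof -
  let ?Q = "steal y t f"
  have st: "state_at G ?Q t = state_at G P t" by (simp add: state_steal)
  have usable_eq: "usable_secrets (acts G ?Q t) (state_at G P t) w =
     usable_secrets (acts G P t) (state_at G P t) w"
    for w by (cases "w = y") (simp_all add: usable_secrets_def acts_steal_honest)
  have claims: "claims G t (acts G ?Q t) (state_at G P t) e"
    if "claims G t (acts G P t) (state_at G P t) e" "e \<in> out_arcs G r" for e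
    using that assms(1)
    by (cases "head G e = y")
      (auto simp: claims_def usable_eq acts_steal_honest acts_steal steal_action_def)
  from assms(2) show ?thesis
  proof (cases rule: secrets_SucE)
    case usable
    then show ?thesis using usable_eq by (auto simp: secrets_Suc next_secrets_def st)
  next
    case (message w)
    then have "(r, Secret x) \<in> send (acts G ?Q t w)"
      using assms(1) by (cases "w = y") (auto simp: acts_steal_honest acts_steal steal_action_def)
    then show ?thesis using message usable_eq st secret_delivered by metis
  next
    case (claim e c)
    then show ?thesis using claims seller_learns_secret[of G t ?Q e c] st by auto
  qed
qed

text \<open>
  The case distinction on \<open>tau f\<close> is forced by message delay: a secret known to some deviator at
  time \<open>t + 1\<close> reaches the buyer of \<open>f\<close> only at \<open>t + 2\<close>, so for \<open>tau f \<le> t + 1\<close> one uses that the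
  buyer knows it in the conforming execution.
\<close>

lemma steal_exposed:
  assumes f: "f \<in> out_arcs G y" "placed (Suc t) f"
    and r: "r \<in> verts G" "r \<noteq> y" "prot f \<in> secrets (state_at G P (Suc t)) r"
  shows "f \<in> transferred G (steal y t f)"
proof -
  let ?Q = "steal y t f"
  have arc: "f \<in> arcs G" and hd: "head G f \<noteq> y" "head G f \<in> verts G" using f out_arcD[OF f(1)] by auto
  note cl = claims_at_tau[OF arc]
  consider "tau f < t" | "tau f = t" | "tau f = Suc t" | "Suc t < tau f" by linarith
  then show ?thesis
  proof cases
    case 1
    then show ?thesis
      using cl by (auto simp: transferred_iff acts_steal_before state_steal intro!: exI[of _ "tau f"])
  next
    case 2
    then have "claims G t (acts G ?Q t) (state_at G ?Q t) f"
      using cl hd by (auto simp: claims_def state_steal acts_steal steal_action_def usable_secrets_def)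
    then show ?thesis by (auto simp: transferred_iff)
  next
    case 3
    have "prot f \<in> secrets (state_at G P (Suc t)) (head G f)"
      using buyer_knows_secret[OF cl] f(2) prot_known(2)[OF f(2)] 3 by (auto simp: placed_iff)
    then show ?thesis
      using 3 hd by (intro steal_succeeds[OF f, of "head G f" "Suc t"] secrets_steal_others) auto
  next
    case 4
    then show ?thesis using r by (intro steal_succeeds[OF f, of r "Suc t"] secrets_steal_others) auto
  qed
qed

lemma safe_in_transferred:
  assumes "y \<in> verts G" and "Q y = P y" and "f \<in> out_arcs G y" and "f \<in> transferred G Q"
  shows "in_arcs G y \<subseteq> transferred G Q"
  using safe assms unfolding safe_def by blast

text \<open>The theft of \<open>f\<close> succeeds, so by safety \<open>y\<close> claims
  \<open>e\<close> during it, with a contract frozen at time \<open>t\<close> and only the knowledge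
  left to it. That \<open>e\<close> is placed at \<open>t\<close>, not just at \<open>Suc t\<close>,
  drives the later minimality arguments.\<close>

lemma exposed_imp_in_secured:
  assumes f: "f \<in> out_arcs G y" "placed (Suc t) f"
    and r: "r \<in> verts G" "r \<noteq> y" "prot f \<in> secrets (state_at G P (Suc t)) r"
    and e: "e \<in> in_arcs G y"
  shows "placed t e" and "prot e = y \<or> prot e \<in> secrets (state_at G P t) y \<or>
    prot e = prot f \<and> tau f < tau e"
proof -
  have "e \<in> transferred G (steal y t f)"
    using safe_in_transferred[OF _ steal_honest f(1) steal_exposed[OF f r]] f(1) e tail_in_verts[of f]
    by (metis in_out_arcs_conv subsetD)
  then show "placed t e" and "prot e = y \<or> prot e \<in> secrets (state_at G P t) y \<or>
    prot e = prot f \<and> tau f < tau e"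
    using honest_claim_under_steal[OF f e] by (fastforce simp: transferred_iff)+
qed

subsection \<open>No relevant secret is leaked before all contracts are placed\<close>

definition leaked :: "nat \<Rightarrow> 'v set" where
  "leaked t = {x. \<exists>r \<in> verts G. r \<noteq> x \<and> x \<in> secrets (state_at G P t) r}"

text \<open>
  A party whose outgoing contract carries a good protector could be robbed by the others, so by
  safety its incoming contracts are already placed; the point of the definition is that they
  again carry good protectors, so that the argument propagates backwards through the digraph.
\<close>

inductive good :: "nat \<Rightarrow> 'v set \<Rightarrow> 'v \<Rightarrow> bool" for t U where
  base: "x \<in> U \<union> leaked t \<Longrightarrow> good t U x"
| step: "f \<in> arcs G \<Longrightarrow> placed t f \<Longrightarrow> good t U (prot f) \<Longrightarrow> prot f \<noteq> tail G f \<Longrightarrow>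
    good t U (tail G f)"

lemma good_in_arcs:
  assumes U: "\<forall>u \<in> U. \<forall>e \<in> in_arcs G u. placed t e \<and> good (Suc t) U (prot e)"
    and f: "f \<in> out_arcs G y" "placed (Suc t) f" "good (Suc t) U (prot f)"
    and e: "e \<in> in_arcs G y"
  shows "placed t e \<and> good (Suc t) U (prot e)"
proof -
  have exposed: ?thesis
    if g: "g \<in> out_arcs G y" "placed (Suc t) g" "good (Suc t) U (prot g)"
      and unsafe: "prot g \<noteq> y \<or> prot g \<in> leaked (Suc t)" for g
  proof -
    \<comment> \<open>The thief is a party to which the secret of \<open>y\<close> has leaked, or
      else \<open>prot g\<close> itself.\<close>
    obtain r where r: "r \<in> verts G" "r \<noteq> y" "prot g \<in> secrets (state_at G P (Suc t)) r"
    proof (cases "prot g = y")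
      case True
      then show ?thesis using that unsafe unfolding leaked_def by blast
    next
      case False
      then show ?thesis using prot_known[OF g(2)] that(1)[of "prot g"] by blast
    qed
    note secured = exposed_imp_in_secured[OF g(1,2) r e]
    have "good (Suc t) U y"
      using g good.step[of g "Suc t" U] by (cases "prot g = y") auto
    moreover have "good (Suc t) U (prot e)"
      if "prot e \<noteq> y" "prot e \<in> secrets (state_at G P t) y"
    proof (rule good.base)
      have "prot e \<in> secrets (state_at G P (Suc t)) y"
        using that secrets_mono[of t "Suc t" G P y] by auto
      moreover have "y \<in> verts G" using e by auto
      ultimately show "prot e \<in> U \<union> leaked (Suc t)" using that by (auto simp: leaked_def)
    qed
    ultimately show ?thesis using secured g(3) by metis
  qed
  show ?thesis
  proof (cases "prot f \<noteq> y \<or> prot f \<in> leaked (Suc t)")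
    case True
    then show ?thesis using exposed f by blast
  next
    case False
    then have "prot f = y" "y \<notin> leaked (Suc t)" by auto
    \<comment> \<open>Only \<open>y\<close> knows the secret for \<open>f\<close>, so
      \<open>f\<close> cannot be stolen yet. But \<open>y\<close> is good either as a member of
      \<open>U\<close> or because of another outgoing contract \<open>g\<close> with a foreign
      protector, which can be stolen instead.\<close>
    from f(3) show ?thesis unfolding \<open>prot f = y\<close>
    proof cases
      case base
      then show ?thesis using \<open>y \<notin> leaked (Suc t)\<close> U e by blast
    next
      case (step g)
      then show ?thesis using exposed[of g] by auto
    qed
  qed
qed

text \<open>Having a placed outgoing contract with a good protector passes to predecessors, hence to
  all parties. Data at \<open>Suc t\<close> thus yield contracts already at
  \<open>t\<close>.\<close>

lemma all_placed_of_good: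
  assumes U: "\<forall>u \<in> U. \<forall>e \<in> in_arcs G u. placed t e \<and> good (Suc t) U (prot e)"
    and f: "f \<in> arcs G" "placed (Suc t) f" "good (Suc t) U (prot f)"
    and e: "e \<in> arcs G"
  shows "placed t e"
proof -
  define S where "S w \<longleftrightarrow> (\<exists>g \<in> out_arcs G w. placed (Suc t) g \<and> good (Suc t) U (prot g))" for w
  have pred: "placed t e \<and> S (tail G e)" if "e \<in> arcs G" "S (head G e)" for e
  proof -
    have "placed t e \<and> good (Suc t) U (prot e)"
      using that good_in_arcs[OF U] by (auto simp: S_def)
    then show ?thesis using that placed_mono[of t e "Suc t"] by (auto simp: S_def)
  qed
  have "S (tail G f)" using f by (auto simp: S_def)
  then have "S (head G e)"
    by (rule all_verts_of_pred_closed) (use pred f e in simp_all)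
  then show ?thesis using pred e by blast
qed

section \<open>The first time at which all contracts exist\<close>

definition start :: nat where
  "start = (LEAST t. \<forall>e \<in> arcs G. placed t e)"

lemma placed_start: "e \<in> arcs G \<Longrightarrow> placed start e"
proof -
  obtain h where h: "\<And>e. e \<in> arcs G \<Longrightarrow> placed (h e) e" using eventually_placed by metis
  have "\<forall>e \<in> arcs G. placed (Max (h ` arcs G)) e"
    using h placed_mono by (metis Max_ge finite_arcs finite_imageI imageI)
  then have "\<forall>e \<in> arcs G. placed start e" unfolding start_def by (rule LeastI)
  then show "e \<in> arcs G \<Longrightarrow> placed start e" by blast
qed

lemma placed_after_start: "e \<in> arcs G \<Longrightarrow> start \<le> t \<Longrightarrow> placed t e"
  using placed_start placed_mono by blast

text \<open>A leaked protector is good with \<open>U\<close> empty, so all contracts would exist one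
  step before \<open>start\<close>, against its minimality.\<close>

lemma secret_at_start:
  assumes "e \<in> arcs G" and "w \<in> verts G" and "prot e \<in> secrets (state_at G P start) w"
  shows "w = prot e"
proof (rule ccontr)
  assume "w \<noteq> prot e"
  then have leak: "prot e \<in> leaked start" using assms by (auto simp: leaked_def)
  have "start \<noteq> 0"
  proof
    assume "start = 0"
    then show False using assms(3) by (simp add: initial_state_def)
  qed
  then obtain t where t: "start = Suc t" by (cases start) auto
  have "\<forall>e' \<in> arcs G. placed t e'"
    using all_placed_of_good[of "{}" t e] leak placed_start[OF assms(1)] assms(1)
    by (auto simp: t intro: good.base)
  then have "start \<le> t" unfolding start_def by (rule Least_le)
  then show False using t by simp
qed

subsection \<open>Contracts protected by another party\<close>

lemma out_foreign_imp_in: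
  assumes f: "f \<in> out_arcs G v" "prot f \<noteq> v" and e: "e \<in> in_arcs G v"
  shows "prot e = v \<or> prot e = prot f \<and> tau f < tau e"
proof -
  have pl: "placed (Suc start) f" using f placed_after_start by simp
  have "prot e \<notin> secrets (state_at G P start) v" if "prot e \<noteq> v"
    using that secret_at_start[of e v] e by auto
  then show ?thesis
    using exposed_imp_in_secured(2)[OF f(1) pl prot_known(1)[OF pl] f(2) prot_known(2)[OF pl] e]
    by blast
qed

lemma out_foreign_imp_in_exists:
  assumes f: "f \<in> out_arcs G v" "prot f \<noteq> v"
  shows "\<exists>e \<in> in_arcs G v. prot e = prot f \<and> tau f < tau e"
proof -
  have "\<exists>e \<in> in_arcs G v. prot e \<noteq> v"
  proof (rule ccontr)
    assume own: "\<not> ?thesis"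
    obtain s where "placed s f" using eventually_placed f by auto
    moreover have "\<not> placed 0 f" by (simp add: placed_def initial_state_def)
    ultimately obtain t where t: "\<not> placed t f" "placed (Suc t) f"
      using ex_least_nat_less[of "\<lambda>t. placed t f" s] by auto
    \<comment> \<open>\<open>Suc t\<close> is the first time at which \<open>f\<close> exists. As
      all incoming contracts of \<open>v\<close> are protected by \<open>v\<close>, the choice
      \<open>U = {v}\<close> meets its own hypothesis and makes \<open>v\<close> good, leaked or
      not; so \<open>f\<close> would exist at \<open>t\<close>.\<close>
    have "\<forall>u \<in> {v}. \<forall>e \<in> in_arcs G u. placed t e \<and> good (Suc t) {v} (prot e)"
      using own good.base[of v "{v}"]
        exposed_imp_in_secured(1)[OF f(1) t(2) prot_known(1)[OF t(2)] f(2) prot_known(2)[OF t(2)]]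
      by auto
    moreover obtain e where "e \<in> in_arcs G v" using in_arcs_nonempty[OF f(1)] by blast
    ultimately have "placed t f"
      using all_placed_of_good[of "{v}" t e f] placed_mono[of t e "Suc t"] f by auto
    then show False using t by simp
  qed
  then show ?thesis using out_foreign_imp_in[OF f] by blast
qed

text \<open>By safety a conforming seller acquires all its incoming assets, so their tails are
  sellers too, and different from \<open>v\<close> by \<open>none\<close>. Backwards along walks
  this reaches \<open>v\<close> itself, a contradiction.\<close>

lemma single_deviator:
  assumes Q: "\<And>w. w \<in> verts G \<Longrightarrow> w \<noteq> v \<Longrightarrow> Q w = P w" and v: "v \<in> verts G"
    and none: "out_arcs G v \<inter> transferred G Q = {}"
  shows "transferred G Q = {}"
proof (rule ccontr)
  assume "transferred G Q \<noteq> {}"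
  then obtain g where g: "g \<in> transferred G Q" by blast
  then have "g \<in> arcs G" by (simp add: transferred_def)
  define S where "S w \<longleftrightarrow> (w \<noteq> v \<and> out_arcs G w \<inter> transferred G Q \<noteq> {})" for w
  have start: "S (tail G e)" if "e \<in> transferred G Q" for e
    using that none by (auto simp: S_def transferred_def)
  have "S v"
  proof (rule all_verts_of_pred_closed[of S "tail G g"])
    show "S (tail G e)" if "e \<in> arcs G" "S (head G e)" for e
    proof -
      have "in_arcs G (head G e) \<subseteq> transferred G Q"
        using that Q safe_in_transferred[of "head G e" Q] head_in_verts[of e]
        unfolding S_def by blast
      then show ?thesis using start that by auto
    qed
  qed (use g start v \<open>g \<in> arcs G\<close> in auto)
  then show False by (simp add: S_def)
qed

text \<open>
  Otherwise all outgoing contracts of \<open>v\<close> are protected by \<open>v\<close>, and by safety \<open>v\<close> must not reveal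
  its secret before it knows the secret of \<open>prot e\<close>. Once it does, \<open>v\<close> could just claim \<open>e\<close> and
  stop, which harms some other party.
\<close>

lemma in_foreign_imp_out_exists:
  assumes e: "e \<in> in_arcs G v" "prot e \<noteq> v"
  shows "\<exists>f \<in> out_arcs G v. prot f = prot e \<and> tau f < tau e"
proof (rule ccontr)
  assume none: "\<not> ?thesis"
  have arc: "e \<in> arcs G" and v: "v \<in> verts G" and hd: "head G e = v" using e by auto
  have own: "prot f = v" if "f \<in> out_arcs G v" for f
    using that none out_foreign_imp_in[OF that _ e(1)] e(2) by metis
  note cl = claims_at_tau[OF arc]
  have htlc: "htlcs (state_at G P (tau e)) e = Some (contract e)"
    using cl htlcs_eq_contract by (auto simp: claims_def)
  have "prot e \<in> secrets (state_at G P (tau e)) v"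
    using buyer_knows_secret[OF cl htlc] e by auto
  define t2 where "t2 = (LEAST t. prot e \<in> secrets (state_at G P t) v)"
  have t2: "prot e \<in> secrets (state_at G P t2) v" "t2 \<le> tau e"
    unfolding t2_def using \<open>prot e \<in> secrets (state_at G P (tau e)) v\<close>
    by (auto intro: LeastI Least_le)
  have "\<not> t2 \<le> start"
    using secret_at_start[OF arc v] secrets_mono[of t2 start G P v] t2(1) e(2) by auto
  then obtain t where t: "t2 = Suc t" "start \<le> t" by (cases t2) auto
  have not_yet: "prot e \<notin> secrets (state_at G P t) v"
    using not_less_Least[of t "\<lambda>t. prot e \<in> secrets (state_at G P t) v"] t(1) t2_def by simp
  obtain f0 where f0: "f0 \<in> out_arcs G v" using out_arcs_nonempty[OF e(1)] by blast
  \<comment> \<open>Otherwise \<open>f0\<close> could be stolen, and safety would require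
    \<open>v\<close> to know the secret for \<open>e\<close> at \<open>t\<close>, before
    \<open>t2\<close>.\<close>
  have hidden_t2: "v \<notin> secrets (state_at G P t2) r" if "r \<in> verts G" "r \<noteq> v" for r
  proof
    assume "v \<in> secrets (state_at G P t2) r"
    then show False
      using exposed_imp_in_secured(2)[OF f0 _ that _ e(1), of t] own[OF f0] not_yet e(2) f0 t
        placed_after_start[of f0 "Suc t"] by auto
  qed

  define A where "A s w = (if s < t2 then acts G P s w else idle\<lparr>claim := {e}\<rparr>)" for s w
  define Q where "Q = deviate P {v} A"
  have Q_other: "Q w = P w" if "w \<noteq> v" for w using that by (simp add: Q_def deviate_outside)
  have state_Q: "state_at G Q s = state_at G P s" if "s \<le> t2" for s
    unfolding Q_def using that
    by (intro state_at_eq_of_trace_eq trace_deviate[of t2]) (auto simp: A_def)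
  have acts_Q: "acts G Q s v = idle\<lparr>claim := {e}\<rparr>" if "t2 \<le> s" for s
    using that v by (simp add: Q_def acts_deviate_in A_def)
  have htlcs_Q: "c = contract f" if "htlcs (state_at G Q s) f = Some c" for s f c
  proof (cases "s \<le> t2")
    case True
    then show ?thesis using that htlcs_eq_contract by (simp add: state_Q)
  next
    case False
    have "htlcs (state_at G Q t2) f = Some (contract f)"
      using placed_after_start[OF htlcs_imp_arc[OF that], of t2] t
      by (simp add: state_Q placed_iff)
    then show ?thesis using htlcs_mono[of G Q t2 f "contract f" s] False that by simp
  qed
  \<comment> \<open>From \<open>t2\<close> on, \<open>v\<close> sends nothing and claims only
    \<open>e\<close>, which reveals a foreign secret; nobody else can be the first to pass on the
    secret of \<open>v\<close>.\<close>
  have hidden: "\<forall>r \<in> verts G - {v}. v \<notin> secrets (state_at G Q s) r" for s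
  proof (cases "s \<le> t2")
    case True
    then show ?thesis using hidden_t2 secrets_mono[of s t2 G P] by (auto simp: state_Q)
  next
    case False
    then have "t2 \<le> s" by simp
    then show ?thesis
    proof (induction rule: dec_induct)
      case base
      then show ?case using hidden_t2 by (auto simp: state_Q)
    next
      case (step s)
      show ?case
      proof (intro ballI notI)
        fix r
        assume r: "r \<in> verts G - {v}" and "v \<in> secrets (state_at G Q (Suc s)) r"
        from this(2) show False
        proof (cases rule: secrets_SucE)
          case usable
          then show ?thesis using r step.IH by (auto simp: usable_secrets_def split: if_splits)
        next
          case (message w)
          then have "w \<noteq> v" using acts_Q[OF step(1)] by auto
          then show ?thesis
            using message step.IH by (auto simp: usable_secrets_def split: if_splits)
        next
          case (claim g c)
          then have "g \<in> arcs G" by simp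
          then have "head G g = v"
            using buyer_knows_secret[OF claim(2,3)] claim(4) step.IH by auto
          then have "g = e" using claim(2) acts_Q[OF step(1)] by (simp add: claims_def)
          then show ?thesis using htlcs_Q[OF claim(3)] claim(4) e(2) by simp
        qed
      qed
    qed
  qed
  have "e \<in> transferred G Q"
    using arc hd t t2 placed_after_start[OF arc, of t2]
    by (intro transferredI[where t = t2 and c = "contract e"])
      (auto simp: acts_Q state_Q placed_iff usable_secrets_def)
  moreover have "out_arcs G v \<inter> transferred G Q = {}"
  proof -
    have False if f: "f \<in> out_arcs G v" and tr: "f \<in> transferred G Q" for f
    proof -
      obtain s where s: "claims G s (acts G Q s) (state_at G Q s) f"
        using tr by (auto simp: transferred_iff)
      then obtain c where c: "htlcs (state_at G Q s) f = Some c" by (auto simp: claims_def)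
      then have "protector c = v" using htlcs_Q own[OF f] by metis
      then show False
        using buyer_knows_secret[OF s c] hidden[of s] out_arcD[OF f] by auto
    qed
    then show ?thesis by blast
  qed
  ultimately show False using single_deviator[of v Q] Q_other v by blast
qed

subsection \<open>Contracts protected by the party itself\<close>

text \<open>While the seller is not the protector, move to an incoming contract of the seller with
  the same protector and larger timeout. Timeouts are bounded since there are finitely many
  arcs.\<close>

lemma exists_out_own:
  assumes "e \<in> arcs G"
  shows "\<exists>g \<in> out_arcs G (prot e). prot g = prot e \<and> (g = e \<or> tau e < tau g)"
  using assms
proof (induction "Max (tau ` arcs G) - tau e" arbitrary: e rule: less_induct)
  case less
  show ?case
  proof (cases "tail G e = prot e")
    case True
    then show ?thesis using less.prems by auto
  next
    case False
    then obtain e' where e': "e' \<in> in_arcs G (tail G e)" "prot e' = prot e" "tau e < tau e'"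
      using out_foreign_imp_in_exists[of e "tail G e"] less.prems by auto
    have "tau e' \<le> Max (tau ` arcs G)" using e' by auto
    then have "Max (tau ` arcs G) - tau e' < Max (tau ` arcs G) - tau e" using e'(3) by linarith
    then obtain g where "g \<in> out_arcs G (prot e')" "prot g = prot e'" "g = e' \<or> tau e' < tau g"
      using less.hyps[of e'] e'(1) by auto
    then show ?thesis using e' by auto
  qed
qed

text \<open>The mirror image: follow outgoing contracts of the buyer with decreasing timeouts until
  the buyer is the protector.\<close>

lemma exists_in_own:
  assumes "f \<in> arcs G"
  shows "\<exists>e \<in> in_arcs G (prot f). prot e = prot f \<and> (e = f \<or> tau e < tau f)"
  using assms
proof (induction "tau f" arbitrary: f rule: less_induct)
  case less
  show ?case
  proof (cases "head G f = prot f")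
    case True
    then show ?thesis using less.prems by auto
  next
    case False
    then obtain f' where f': "f' \<in> out_arcs G (head G f)" "prot f' = prot f" "tau f' < tau f"
      using in_foreign_imp_out_exists[of f "head G f"] less.prems by auto
    then obtain e where "e \<in> in_arcs G (prot f')" "prot e = prot f'" "e = f' \<or> tau e < tau f'"
      using less.hyps[of f'] by auto
    then show ?thesis using f' by auto
  qed
qed

text \<open>The walk starts with an incoming contract of \<open>tail G e\<close>. Either it stops
  there, and the seller of \<open>e\<close> is the buyer of \<open>g\<close>, or a second strict
  increase gains one more time step.\<close>

lemma in_own_imp_out:
  assumes e: "e \<in> in_arcs G v" "prot e = v"
  shows "\<exists>g \<in> out_arcs G v. prot g = v \<and>
    (Suc (tau e) < tau g \<or> tau e < tau g \<and> head G g = tail G e)"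
proof -
  obtain e' where e': "e' \<in> in_arcs G (tail G e)" "prot e' = v" "tau e < tau e'"
    using out_foreign_imp_in_exists[of e "tail G e"] in_arcD[OF e(1)] e by auto
  then obtain g where "g \<in> out_arcs G v" "prot g = v" "g = e' \<or> tau e' < tau g"
    using exists_out_own[of e'] by auto
  then show ?thesis using e' by auto
qed

text \<open>
  If \<open>tau e \<le> tau f\<close>, then stealing \<open>f\<close> forces \<open>v\<close> to claim \<open>e\<close>, hence to reveal its own secret,
  without knowing the secret of \<open>prot f\<close>. The others may then steal some \<open>g\<close> protected by \<open>v\<close>
  instead and never reveal the secret of \<open>prot f\<close>. The sharp form of the bound on \<open>tau g\<close> above
  leaves enough time to pass the secret of \<open>v\<close> on to the buyer of \<open>g\<close>.
\<close>

lemma out_foreign_before_in_own: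
  assumes f: "f \<in> out_arcs G v" "prot f \<noteq> v" and e: "e \<in> in_arcs G v" "prot e = v"
  shows "tau f < tau e"
proof (rule ccontr)
  assume "\<not> tau f < tau e"
  then have le: "tau e \<le> tau f" by simp
  have arcs: "e \<in> arcs G" "f \<in> arcs G" and v: "v \<in> verts G" and hd: "head G e = v"
    using e f head_in_verts[of e] by auto
  note tl = in_arcD[OF e(1)]
  let ?D = "steal v start f"
  have pl: "placed (Suc start) h" if "h \<in> out_arcs G v" for h
    using that placed_after_start by simp
  have "f \<in> transferred G ?D"
    using steal_exposed[OF f(1) pl[OF f(1)] prot_known(1)[OF pl[OF f(1)]] f(2)]
      prot_known(2)[OF pl[OF f(1)]] by simp
  then have "e \<in> transferred G ?D"
    using safe_in_transferred[of v ?D f] steal_honest v f(1) e(1) by blast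
  then obtain s where s: "claims G s (acts G ?D s) (state_at G ?D s) e"
    by (auto simp: transferred_iff)
  have s_le: "s \<le> tau e"
    using honest_claim_under_steal[OF f(1) pl[OF f(1)] e(1) s] by simp
  \<comment> \<open>An earlier claim would be part of the conforming execution and leak the secret
    of \<open>v\<close> to the seller of \<open>e\<close> by \<open>start\<close>.\<close>
  have start_le: "start \<le> s"
  proof (rule ccontr)
    assume "\<not> start \<le> s"
    then have "s < start" by simp
    then have cl: "claims G s (acts G P s) (state_at G P s) e"
      using s by (simp add: acts_steal_before state_steal)
    then obtain c where "htlcs (state_at G P s) e = Some c" by (auto simp: claims_def)
    then have "v \<in> secrets (state_at G P (Suc s)) (tail G e)"
      using seller_learns_secret[OF cl] htlcs_eq_contract e(2) by auto
    then have "v \<in> secrets (state_at G P start) (tail G e)"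
      using secrets_mono[of "Suc s" start G P "tail G e"] \<open>s < start\<close> by auto
    then show False using secret_at_start[OF arcs(1)] tl e(2) by auto
  qed
  obtain g where g: "g \<in> out_arcs G v" "prot g = v"
      "Suc (tau e) < tau g \<or> tau e < tau g \<and> head G g = tail G e"
    using in_own_imp_out[OF e] by blast
  let ?D' = "steal v start g"
  \<comment> \<open>The two scripts differ only at \<open>tau f\<close> and \<open>tau g\<close>,
    neither of which is before \<open>s\<close>; so \<open>v\<close> cannot tell the thefts apart
    when it claims \<open>e\<close>.\<close>
  have tr: "trace G ?D' s = trace G ?D s"
    unfolding steal_def using s_le le g(3)
    by (intro trace_deviate_cong[of s]) (auto simp: steal_action_def)
  have st: "state_at G ?D' s = state_at G ?D s" by (rule state_at_eq_of_trace_eq[OF tr])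
  have act: "acts G ?D' s v = acts G ?D s v"
    by (rule acts_eq_of_trace_eq[OF tr]) (simp add: steal_honest)
  have cl: "claims G s (acts G ?D' s) (state_at G ?D' s) e"
    using s by (simp add: claims_def usable_secrets_def st act hd)
  have "htlcs (state_at G ?D' s) e = Some (contract e)"
    using htlcs_steal_in[OF e(1) start_le] placed_start[OF arcs(1)] by (simp add: placed_iff)
  then have "v \<in> secrets (state_at G ?D' (Suc s)) (tail G e)"
    using seller_learns_secret[OF cl] e(2) by auto
  moreover have "Suc s < tau g \<or> Suc s = tau g \<and> tail G e = head G g" using g(3) s_le by auto
  ultimately have "g \<in> transferred G ?D'"
    using steal_succeeds[OF g(1) pl[OF g(1)], of "tail G e" "Suc s"] tl g(2) start_le by auto
  moreover obtain h where h: "h \<in> in_arcs G v" "prot h = prot f"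
    using out_foreign_imp_in_exists[OF f] by blast
  ultimately have "h \<in> transferred G ?D'"
    using safe_in_transferred[of v ?D' g] steal_honest v g(1) by blast
  then obtain s' where "claims G s' (acts G ?D' s') (state_at G ?D' s') h"
    by (auto simp: transferred_iff)
  \<comment> \<open>In the theft of \<open>g\<close> the only secret revealed to \<open>v\<close> is
    its own, so it must have known that of \<open>prot f\<close> at \<open>start\<close>.\<close>
  from honest_claim_under_steal[OF g(1) pl[OF g(1)] h(1) this]
  have "prot h \<in> secrets (state_at G P start) v" using h f(2) g(2) by auto
  then show False using secret_at_start[of h v] h v f(2) by auto
qed

end

section \<open>The three claims about the contracts of one party\<close>

theorem theorem4:
  fixes G :: "('v, 'a) pre_digraph"
    and pref :: "'v set \<Rightarrow> 'a outcome rel"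
    and P :: "('v, 'a) protocol"
    and v :: 'v
  assumes "digraph G"
    and "strongly_connected G"
    and "preferences G pref"
    and "atomic G pref P"
    and claimed_at_timeout:
      "\<forall>e \<in> arcs G. \<exists>c. has_htlc G P e c \<and> claimed_at G P e (timeout c)"
    and "v \<in> verts G"
  shows
    "(\<forall>x \<in> verts G.
        (\<exists>e \<in> in_arcs G v. protects G P x e) \<longleftrightarrow> (\<exists>f \<in> out_arcs G v. protects G P x f)) \<and>
     ((\<exists>e \<in> in_arcs G v \<union> out_arcs G v. protects G P v e) \<longrightarrow>
        (\<exists>e \<in> in_arcs G v. \<exists>c. has_htlc G P e c \<and> protector c = v \<and>
           (\<forall>f \<in> out_arcs G v. \<forall>d. has_htlc G P f d \<and> protector d = v \<longrightarrow>
              timeout c < timeout d))) \<and>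
     (\<forall>x \<in> verts G. \<forall>y \<in> verts G. x \<noteq> v \<and> y \<noteq> v \<and>
        (\<exists>e \<in> in_arcs G v \<union> out_arcs G v. protects G P x e) \<and>
        (\<exists>e \<in> in_arcs G v \<union> out_arcs G v. protects G P y e) \<longrightarrow> x = y) \<and>
     (\<forall>x \<in> verts G. x \<noteq> v \<and> (\<exists>e \<in> in_arcs G v \<union> out_arcs G v. protects G P x e) \<longrightarrow>
        (\<forall>f \<in> out_arcs G v. \<forall>d. has_htlc G P f d \<and> protector d = x \<longrightarrow>
           (\<forall>e \<in> in_arcs G v. \<forall>c. has_htlc G P e c \<longrightarrow> timeout d < timeout c)))"
proof -
  interpret digraph G by fact
  interpret timely_safe_swap G P
    using assms by unfold_locales (auto simp: atomic_def)
  have protects: "protects G P x e \<longleftrightarrow> prot e = x" if "e \<in> arcs G" for x e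
    using that by (auto simp: protects_def has_htlc_iff)
  have in_out: "(\<exists>e \<in> in_arcs G v. prot e = x) \<longleftrightarrow> (\<exists>f \<in> out_arcs G v. prot f = x)" for x
  proof
    assume "\<exists>e \<in> in_arcs G v. prot e = x"
    then obtain e where e: "e \<in> in_arcs G v" "prot e = x" by blast
    then show "\<exists>f \<in> out_arcs G v. prot f = x"
      using in_own_imp_out[of e v] in_foreign_imp_out_exists[of e v] by (cases "x = v") blast+
  next
    assume "\<exists>f \<in> out_arcs G v. prot f = x"
    then obtain f where f: "f \<in> out_arcs G v" "prot f = x" by blast
    then show "\<exists>e \<in> in_arcs G v. prot e = x"
      using exists_in_own[of f] out_foreign_imp_in_exists[of f v] by (cases "x = v") auto
  qed
  have own: "\<exists>e \<in> in_arcs G v. prot e = v \<and> (\<forall>f \<in> out_arcs G v. prot f = v \<longrightarrow> tau e < tau f)"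
    if ex: "\<exists>f \<in> out_arcs G v. prot f = v"
  proof -
    \<comment> \<open>Take \<open>f\<close> of least timeout: descending from it gives an
      \<open>e\<close> below all of them, and \<open>e\<close> differs from \<open>f\<close> because
      there are no loops.\<close>
    obtain f where f: "f \<in> out_arcs G v" "prot f = v"
        "\<And>g. g \<in> out_arcs G v \<Longrightarrow> prot g = v \<Longrightarrow> tau f \<le> tau g"
      using ex ex_has_least_nat[of "\<lambda>f. f \<in> out_arcs G v \<and> prot f = v" _ tau] by blast
    obtain e where "e \<in> in_arcs G v" "prot e = v" "e = f \<or> tau e < tau f"
      using exists_in_own[of f] f by auto
    moreover have "e \<noteq> f" using out_arcD[OF f(1)] \<open>e \<in> in_arcs G v\<close> by auto
    ultimately show ?thesis using f(3) by (metis order_less_le_trans)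
  qed
  have foreign: "(prot e = v \<or> prot e = prot f) \<and> tau f < tau e"
    if "f \<in> out_arcs G v" "prot f \<noteq> v" "e \<in> in_arcs G v" for e f
    using out_foreign_imp_in[OF that] out_foreign_before_in_own[OF that] by blast
  have protects_in: "(\<exists>e \<in> in_arcs G v. protects G P x e) \<longleftrightarrow> (\<exists>e \<in> in_arcs G v. prot e = x)" for x
    by (rule bex_cong) (auto simp: protects)
  have protects_out: "(\<exists>f \<in> out_arcs G v. protects G P x f) \<longleftrightarrow> (\<exists>f \<in> out_arcs G v. prot f = x)" for x
    by (rule bex_cong) (auto simp: protects)
  have involved: "(\<exists>e \<in> in_arcs G v \<union> out_arcs G v. protects G P x e) \<longleftrightarrow>
      (\<exists>f \<in> out_arcs G v. prot f = x)" for x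
    unfolding bex_Un protects_in protects_out using in_out[of x] by blast
  show ?thesis
  proof (intro conjI ballI impI allI)
    fix x
    show "(\<exists>e \<in> in_arcs G v. protects G P x e) \<longleftrightarrow> (\<exists>f \<in> out_arcs G v. protects G P x f)"
      unfolding protects_in protects_out by (rule in_out)
  next
    assume "\<exists>e \<in> in_arcs G v \<union> out_arcs G v. protects G P v e"
    then obtain e where "e \<in> in_arcs G v" "prot e = v"
        "\<forall>f \<in> out_arcs G v. prot f = v \<longrightarrow> tau e < tau f"
      using own involved by blast
    then show "\<exists>e \<in> in_arcs G v. \<exists>c. has_htlc G P e c \<and> protector c = v \<and>
        (\<forall>f \<in> out_arcs G v. \<forall>d. has_htlc G P f d \<and> protector d = v \<longrightarrow> timeout c < timeout d)"
      by (intro bexI[of _ e] exI[of _ "contract e"]) (auto simp: has_htlc_iff)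
  next
    fix x y
    assume "x \<noteq> v \<and> y \<noteq> v \<and> (\<exists>e \<in> in_arcs G v \<union> out_arcs G v. protects G P x e) \<and>
      (\<exists>e \<in> in_arcs G v \<union> out_arcs G v. protects G P y e)"
    \<comment> \<open>Compare an outgoing contract protected by \<open>x\<close> with an incoming
      one protected by \<open>y\<close>; the latter's protector must be \<open>v\<close> or
      \<open>x\<close>.\<close>
    then show "x = y" using foreign in_out[of y] unfolding involved by metis
  next
    fix x f d e c
    assume "x \<noteq> v \<and> (\<exists>e \<in> in_arcs G v \<union> out_arcs G v. protects G P x e)"
      and "f \<in> out_arcs G v" and "has_htlc G P f d \<and> protector d = x"
      and "e \<in> in_arcs G v" and "has_htlc G P e c"
    then show "timeout d < timeout c"
      using foreign[of f e] by (auto simp: has_htlc_iff)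
  qed
qed

end
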